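(* Let $\mathcal{A}$ be a unital $C^*$-algebra with unit $1$ and center $\mathcal{Z}(\mathcal{A})$. Then the following assertions are equivalent: (i) $\mathcal{Z}(\mathcal{A})=\mathbb{C}1$. (ii) For all invertible elements $a,b\in\mathcal{A}$: if $\|axb\|=\|x\|$ holds for every $x\in\mathcal{A}$, then there exists $\lambda>0$ such that both $\lambda a$ and $\frac{1}{\lambda}b$ are unitary.
   Context: $\mathcal{Z}(\mathcal{A})=\{z\in\mathcal{A} : za=az \text{ for all } a\in\mathcal{A}\}$ denotes the center of $\mathcal{A}$. *)

theory Defs
  imports Complex_Main
begin

text \<open>
  The library's normed-algebra classes are over the reals only, so the complex structure is added
  as a second scalar multiplication extending the real one.  No unit is assumed in
  \<^verbatim>\<open>cstar_algebra\<close>.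
\<close>

class scaleC =
  fixes scaleC :: "complex \<Rightarrow> 'a \<Rightarrow> 'a" (infixr "*\<^sub>C" 75)

class star =
  fixes star :: "'a \<Rightarrow> 'a"

class cstar_algebra = real_normed_algebra + banach + scaleC + star +
  assumes scaleC_add_right: "c *\<^sub>C (x + y) = c *\<^sub>C x + c *\<^sub>C y"
    and scaleC_add_left: "(c + d) *\<^sub>C x = c *\<^sub>C x + d *\<^sub>C x"
    and scaleC_scaleC: "c *\<^sub>C d *\<^sub>C x = (c * d) *\<^sub>C x"
    and scaleC_of_real: "complex_of_real r *\<^sub>C x = r *\<^sub>R x"
    and mult_scaleC_left: "(c *\<^sub>C x) * y = c *\<^sub>C (x * y)"
    and mult_scaleC_right: "x * (c *\<^sub>C y) = c *\<^sub>C (x * y)"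
    and norm_scaleC: "norm (c *\<^sub>C x) = cmod c * norm x"
    and star_add: "star (x + y) = star x + star y"
    and star_scaleC: "star (c *\<^sub>C x) = cnj c *\<^sub>C star x"
    and star_mult: "star (x * y) = star y * star x"
    and star_star: "star (star x) = x"
    and norm_star_mult_self: "norm (star x * x) = (norm x)\<^sup>2"

text \<open>
  The unit comes from \<^class>\<open>monoid_mult\<close> rather than \<^class>\<open>real_normed_algebra_1\<close>, so the zero
  algebra is not excluded.  In a nonzero algebra the unit has norm 1 as a consequence of the
  C*-identity.
\<close>

class unital_cstar_algebra = cstar_algebra + monoid_mult

definition algebra_center :: "'a::times set" where
  "algebra_center = {z. \<forall>a. z * a = a * z}"

definition invertible_elem :: "'a::monoid_mult \<Rightarrow> bool" where
  "invertible_elem a \<longleftrightarrow> (\<exists>b. a * b = 1 \<and> b * a = 1)"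

definition unitary_elem :: "'a::{monoid_mult, star} \<Rightarrow> bool" where
  "unitary_elem u \<longleftrightarrow> star u * u = 1 \<and> u * star u = 1"

instantiation complex :: unital_cstar_algebra
begin

definition scaleC_complex :: "complex \<Rightarrow> complex \<Rightarrow> complex" where
  "scaleC_complex c x = c * x"

definition star_complex :: "complex \<Rightarrow> complex" where
  "star_complex = cnj"

instance
  by standard
    (simp_all add: scaleC_complex_def star_complex_def algebra_simps norm_mult
      scaleR_conv_of_real power2_eq_square)

end

end

theory Submission
  imports Defs "HOL-Analysis.Elementary_Metric_Spaces"
begin

text \<open>
  If \<open>h\<close> is central and invertible, then \<open>x \<mapsto> h x h\<^sup>-\<^sup>1\<close> is the identity, so the condition on
  bimultiplications makes \<open>h\<^sup>* h\<close> scalar. Taking \<open>h = 1 \<plusminus> x\<close> for a small central self-adjoint \<open>x\<close>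
  and subtracting the two squares shows that \<open>x\<close> is scalar.

  Conversely, a surjective linear isometry preserves the extreme points of the unit ball.
  Unitaries are extreme, and an invertible extreme point is unitary. Hence \<open>a u b\<close> is unitary for
  every unitary \<open>u\<close>, that is \<open>u (b b\<^sup>*) u\<^sup>* = (a\<^sup>* a)\<^sup>-\<^sup>1\<close>. The right-hand side does not depend
  on \<open>u\<close>, so \<open>b b\<^sup>*\<close> commutes with all unitaries, which span the algebra. It is therefore central,
  hence a scalar, and so is \<open>a\<^sup>* a\<close>.

  Spectral theory is replaced by the square root of \<open>1 - x\<close> for self-adjoint \<open>x\<close> of norm at most 1.
\<close>

section \<open>Elementary algebra\<close>

lemma star_zero [simp]: "star (0::'a::cstar_algebra) = 0"
  using star_add[of "0::'a" 0] by simp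

lemma star_minus [simp]: "star (- x) = - star (x::'a::cstar_algebra)"
  using star_add[of x "- x"] by (simp add: minus_unique)

lemma star_diff: "star (x - y) = star x - star (y::'a::cstar_algebra)"
  using star_add[of x "- y"] by simp

lemma star_scaleR: "star (r *\<^sub>R x) = r *\<^sub>R star (x::'a::cstar_algebra)"
  by (simp add: star_scaleC flip: scaleC_of_real)

lemma star_one [simp]: "star (1::'a::unital_cstar_algebra) = 1"
  by (metis mult.left_neutral star_mult star_star)

lemma scaleC_one [simp]: "1 *\<^sub>C x = (x::'a::cstar_algebra)"
  using scaleC_of_real[of 1 x] by simp

lemma scaleC_zero_left [simp]: "0 *\<^sub>C x = (0::'a::cstar_algebra)"
  using scaleC_of_real[of 0 x] by simp

lemma scaleC_zero_right [simp]: "c *\<^sub>C 0 = (0::'a::cstar_algebra)"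
  using scaleC_add_right[of c "0::'a" 0] by simp

lemma scaleC_minus_left: "(- c) *\<^sub>C x = - (c *\<^sub>C (x::'a::cstar_algebra))"
  using scaleC_add_left[of c "- c" x] by (simp add: minus_unique)

lemma scaleC_minus_right: "c *\<^sub>C (- x) = - (c *\<^sub>C (x::'a::cstar_algebra))"
  using scaleC_add_right[of c x "- x"] by (simp add: minus_unique)

lemma scaleC_diff_right: "c *\<^sub>C (x - y) = c *\<^sub>C x - c *\<^sub>C (y::'a::cstar_algebra)"
  using scaleC_add_right[of c x "- y"] by (simp add: scaleC_minus_right)

lemma scaleC_scaleR: "c *\<^sub>C (r *\<^sub>R x) = r *\<^sub>R (c *\<^sub>C (x::'a::cstar_algebra))"
  by (simp add: scaleC_scaleC mult.commute flip: scaleC_of_real)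

lemma scaleC_ii_ii: "\<i> *\<^sub>C \<i> *\<^sub>C x = - (x::'a::cstar_algebra)"
  by (simp add: scaleC_scaleC scaleC_minus_left)

lemmas cstar_simps = star_add star_diff star_scaleC star_scaleR star_mult star_star
  scaleC_add_right scaleC_diff_right scaleC_minus_left scaleC_minus_right scaleC_scaleR scaleC_ii_ii
  mult_scaleC_left mult_scaleC_right

lemma norm_star [simp]: "norm (star x) = norm (x::'a::cstar_algebra)"
proof -
  have "norm y \<le> norm (star y)" for y :: 'a
  proof (cases "y = 0")
    case False
    have "norm y * norm y \<le> norm (star y) * norm y"
      using norm_mult_ineq[of "star y" y] by (simp add: norm_star_mult_self power2_eq_square)
    then show ?thesis
      using False by simp
  qed simp
  from this[of x] this[of "star x"] show ?thesis
    by (simp add: star_star)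
qed

lemma norm_selfadjoint_square:
  assumes "star (x::'a::cstar_algebra) = x"
  shows "norm (x * x) = (norm x)\<^sup>2"
  using norm_star_mult_self[of x] assms by simp

text \<open>Only an inequality, because in the zero algebra the unit has norm 0.\<close>

lemma norm_one_le: "norm (1::'a::unital_cstar_algebra) \<le> 1"
proof -
  have "norm (1::'a) * norm (1::'a) = norm (1::'a)"
    using norm_star_mult_self[of "1::'a"] by (simp add: power2_eq_square)
  then show ?thesis
    by (metis mult_cancel_right1 norm_ge_zero order_refl zero_le_one norm_zero)
qed

lemma unitary_norm_le:
  assumes "unitary_elem (u::'a::unital_cstar_algebra)"
  shows "norm u \<le> 1"
proof -
  have "(norm u)\<^sup>2 \<le> 1"
    using norm_star_mult_self[of u] assms norm_one_le[where 'a='a] by (simp add: unitary_elem_def)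
  then show ?thesis
    by (simp add: power_le_one_iff)
qed

lemma norm_mult_le_one:
  fixes x y :: "'a::real_normed_algebra"
  assumes "norm x \<le> 1" "norm y \<le> 1"
  shows "norm (x * y) \<le> 1"
  using norm_mult_ineq[of x y] assms mult_le_one[of "norm x" "norm y"] by simp

text \<open>The explicit formulas allow centrality to pass from \<open>x\<close> and
  \<open>star x\<close> to both parts.\<close>

lemma cartesian_decomposition:
  fixes x :: "'a::cstar_algebra"
  obtains p q where "star p = p" "star q = q" "x = p + \<i> *\<^sub>C q"
    and "p = (1/2) *\<^sub>R (x + star x)" "q = (1/2) *\<^sub>R (\<i> *\<^sub>C (star x - x))"
proof -
  define p where "p = (1/2) *\<^sub>R (x + star x)"
  define q where "q = (1/2) *\<^sub>R (\<i> *\<^sub>C (star x - x))"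
  have "star p = p" "star q = q"
    by (simp_all add: p_def q_def cstar_simps algebra_simps)
  moreover have "x = p + \<i> *\<^sub>C q"
    by (simp add: p_def q_def cstar_simps algebra_simps flip: scaleR_left_distrib)
  ultimately show ?thesis
    using that p_def q_def by blast
qed

section \<open>Square roots\<close>

text \<open>A limit \<open>l\<close> satisfies \<open>l + l = x + l * l\<close>, so
  \<open>1 - l\<close> is a square root of \<open>1 - x\<close>. The type also covers the reals,
  where the iteration at 1 serves as majorant.\<close>

fun sqrt_iter :: "'a::real_normed_algebra \<Rightarrow> nat \<Rightarrow> 'a" where
  "sqrt_iter x 0 = 0"
| "sqrt_iter x (Suc n) = (1/2) *\<^sub>R (x + sqrt_iter x n * sqrt_iter x n)"

lemma sqrt_iter_real_bounds: "0 \<le> sqrt_iter (1::real) n \<and> sqrt_iter (1::real) n \<le> 1"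
proof (induction n)
  case (Suc n)
  then have "sqrt_iter (1::real) n * sqrt_iter 1 n \<le> 1"
    by (simp add: mult_le_one)
  with Suc show ?case
    by (simp add: add_nonneg_nonneg)
qed simp

lemma norm_sqrt_iter_le:
  assumes "norm x \<le> 1"
  shows "norm (sqrt_iter x n) \<le> sqrt_iter 1 n"
proof (induction n)
  case (Suc n)
  have "norm (x + sqrt_iter x n * sqrt_iter x n) \<le> norm x + norm (sqrt_iter x n) * norm (sqrt_iter x n)"
    using norm_triangle_ineq norm_mult_ineq by (meson add_left_mono order_trans)
  also have "\<dots> \<le> 1 + sqrt_iter 1 n * sqrt_iter 1 n"
    using assms Suc by (intro add_mono mult_mono) (auto simp: sqrt_iter_real_bounds)
  finally show ?case
    by simp
qed simp

text \<open>The iteration has nonnegative coefficients, so its increments are dominated by the increments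
  of the real iteration at 1. This gives convergence on the whole closed unit ball.\<close>

lemma norm_sqrt_iter_step:
  assumes "norm x \<le> 1"
  shows "norm (sqrt_iter x (Suc n) - sqrt_iter x n) \<le> sqrt_iter 1 (Suc n) - sqrt_iter 1 n"
proof (induction n)
  case 0
  then show ?case
    using assms by simp
next
  case (Suc n)
  define a b where "a = sqrt_iter x (Suc n)" and "b = sqrt_iter x n"
  define s t where "s = sqrt_iter (1::real) (Suc n)" and "t = sqrt_iter (1::real) n"
  \<comment> \<open>Noncommutative difference of squares: the sum expands to
    \<open>a * a - b * b\<close>.\<close>
  have "norm ((a - b) * a + b * (a - b)) \<le> norm (a - b) * norm a + norm b * norm (a - b)"
    by (intro order_trans[OF norm_triangle_ineq] add_mono norm_mult_ineq)
  also have "\<dots> \<le> (s - t) * s + t * (s - t)"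
    using Suc norm_sqrt_iter_le[OF assms, of "Suc n"] norm_sqrt_iter_le[OF assms, of n]
      sqrt_iter_real_bounds[of n] sqrt_iter_real_bounds[of "Suc n"] norm_ge_zero[of "a - b"] order_trans[OF norm_ge_zero Suc]
    unfolding a_def[symmetric] b_def[symmetric] s_def[symmetric] t_def[symmetric]
    by (intro add_mono mult_mono) auto
  finally have "norm (a * a - b * b) \<le> s * s - t * t"
    by (simp add: algebra_simps)
  moreover have "sqrt_iter x (Suc (Suc n)) - a = (1/2) *\<^sub>R (a * a - b * b)"
    by (simp only: sqrt_iter.simps(2)[of x "Suc n"] a_def[symmetric])
      (simp add: a_def b_def algebra_simps)
  moreover have "sqrt_iter 1 (Suc (Suc n)) - s = (1/2) * (s * s - t * t)"
    by (simp only: sqrt_iter.simps(2)[of 1 "Suc n"] s_def[symmetric])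
      (simp add: s_def t_def algebra_simps)
  ultimately show ?case
    by (simp add: a_def s_def)
qed

text \<open>The real iteration at 1 is monotone and bounded, so its increments are summable. By
  comparison so are those at \<open>x\<close>, and they telescope.\<close>

lemma convergent_sqrt_iter:
  fixes x :: "'a::{real_normed_algebra, banach}"
  assumes "norm x \<le> 1"
  shows "convergent (sqrt_iter x)"
proof -
  have step: "sqrt_iter (1::real) n \<le> sqrt_iter 1 (Suc n)" for n
    using norm_sqrt_iter_step[of "1::real" n] norm_ge_zero by (smt (verit) norm_one)
  have "incseq (sqrt_iter (1::real))"
    using step by (rule incseq_SucI)
  then have conv: "convergent (sqrt_iter (1::real))"
    using sqrt_iter_real_bounds by (metis convergentI incseq_convergent)
  then have "summable (\<lambda>n. sqrt_iter (1::real) (Suc n) - sqrt_iter 1 n)"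
    by (metis convergent_def telescope_summable)
  then have "summable (\<lambda>n. sqrt_iter x (Suc n) - sqrt_iter x n)"
    by (rule summable_comparison_test'[where N = 0]) (rule norm_sqrt_iter_step[OF assms])
  then have "convergent (\<lambda>n. \<Sum>k<n. sqrt_iter x (Suc k) - sqrt_iter x k)"
    by (simp add: summable_iff_convergent)
  then show ?thesis
    by (simp add: sum_lessThan_telescope del: sqrt_iter.simps(2))
qed

lemma sqrt_one_minus:
  fixes x :: "'a::unital_cstar_algebra"
  assumes sa: "star x = x" and le: "norm x \<le> 1"
  obtains r where "star r = r" "r * r = 1 - x" "\<And>y. x * y = y * x \<Longrightarrow> r * y = y * r"
proof -
  obtain l where l: "sqrt_iter x \<longlonglongrightarrow> l"
    using convergent_sqrt_iter[OF le] by (auto simp: convergent_def)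
  have "(\<lambda>n. sqrt_iter x (Suc n)) \<longlonglongrightarrow> (1/2) *\<^sub>R (x + l * l)"
    unfolding sqrt_iter.simps(2) by (intro tendsto_intros l)
  then have "l = (1/2) *\<^sub>R (x + l * l)"
    using LIMSEQ_unique LIMSEQ_Suc[OF l] by blast
  then have "l + l = x + l * l"
    by (metis scaleR_half_double scaleR_right_distrib)
  then have "(1 - l) * (1 - l) = 1 - x"
    by (simp add: algebra_simps)
  moreover have "star (1 - l) = 1 - l"
  proof -
    \<comment> \<open>The iterates are self-adjoint and \<open>star\<close> is isometric, so
      \<open>star l\<close> is a limit of the same sequence.\<close>
    have "star (sqrt_iter x n) = sqrt_iter x n" for n
      by (induction n) (simp_all add: cstar_simps sa)
    then have "norm (sqrt_iter x n - star l) = norm (sqrt_iter x n - l)" for n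
      by (metis norm_star star_diff)
    then have "sqrt_iter x \<longlonglongrightarrow> star l"
      using l unfolding LIMSEQ_iff by simp
    then have "star l = l"
      using l by (rule LIMSEQ_unique)
    then show ?thesis
      by (simp add: star_diff)
  qed
  moreover have "(1 - l) * y = y * (1 - l)" if "x * y = y * x" for y
  proof -
    have "sqrt_iter x n * y = y * sqrt_iter x n" for n
    proof (induction n)
      case (Suc n)
      let ?s = "sqrt_iter x n"
      have "?s * ?s * y = y * (?s * ?s)"
        using Suc by (metis mult.assoc)
      then show ?case
        using that by (simp add: distrib_left distrib_right)
    qed simp
    moreover have "(\<lambda>n. sqrt_iter x n * y) \<longlonglongrightarrow> l * y" "(\<lambda>n. y * sqrt_iter x n) \<longlonglongrightarrow> y * l"
      by (intro tendsto_intros l)+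
    ultimately have "l * y = y * l"
      by (metis (no_types, lifting) LIMSEQ_unique ext)
    then show ?thesis
      by (simp add: algebra_simps)
  qed
  ultimately show ?thesis
    using that by blast
qed

section \<open>Self-adjoint elements\<close>

text \<open>The analogue of cos t + i sin t: commutation of \<open>s\<close> and \<open>d\<close>
  cancels the cross terms, and the squares add up to 1.\<close>

lemma selfadjoint_contraction_unitary:
  fixes d :: "'a::unital_cstar_algebra"
  assumes sa: "star d = d" and le: "norm d \<le> 1"
  obtains s where "star s = s" "s * s = 1 - d * d" "s * d = d * s" "unitary_elem (d + \<i> *\<^sub>C s)"
proof -
  have "norm (d * d) \<le> 1" "star (d * d) = d * d"
    using sa le by (simp_all add: star_mult norm_mult_le_one)
  then obtain s where s: "star s = s" "s * s = 1 - d * d" "s * d = d * s"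
    using sqrt_one_minus by (metis mult.assoc)
  then have "unitary_elem (d + \<i> *\<^sub>C s)"
    by (simp add: unitary_elem_def cstar_simps sa algebra_simps)
  with s that show ?thesis
    by blast
qed

text \<open>\<open>1 - d * d\<close> is the square of \<open>s\<close>, which up to the factor i is
  the skew-adjoint part of a unitary and so has norm at most 1.\<close>

lemma norm_one_minus_square_le:
  fixes d :: "'a::unital_cstar_algebra"
  assumes "star d = d" "norm d \<le> 1"
  shows "norm (1 - d * d) \<le> 1"
proof -
  obtain s where s: "star s = s" "s * s = 1 - d * d" and u: "unitary_elem (d + \<i> *\<^sub>C s)"
    using selfadjoint_contraction_unitary[OF assms] by metis
  define u where "u = d + \<i> *\<^sub>C s"
  have eq: "\<i> *\<^sub>C s = (1/2) *\<^sub>R (u - star u)"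
    by (simp add: u_def cstar_simps s assms algebra_simps flip: scaleR_left_distrib)
  have "norm (u - star u) \<le> norm u + norm u"
    using norm_triangle_ineq4[of u "star u"] by simp
  then have "norm (\<i> *\<^sub>C s) \<le> norm u"
    unfolding eq by simp
  then have "norm s \<le> 1"
    using unitary_norm_le[OF u] by (simp add: norm_scaleC u_def)
  then show ?thesis
    using norm_mult_le_one s by metis
qed

text \<open>For w = k + i r, commutation gives \<open>star w * w = k * k + r * r = 0\<close>, so w
  vanishes by the C*-identity, and so does its adjoint k - i r.\<close>

lemma selfadjoint_squares_opposite:
  fixes k r :: "'a::cstar_algebra"
  assumes "star k = k" "star r = r" "r * k = k * r" "r * r = - (k * k)"
  shows "k = 0"
proof -
  have "star (k + \<i> *\<^sub>C r) * (k + \<i> *\<^sub>C r) = 0"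
    using assms by (simp add: cstar_simps algebra_simps)
  then have "k + \<i> *\<^sub>C r = 0"
    using norm_star_mult_self[of "k + \<i> *\<^sub>C r"] by simp
  moreover have "star (k + \<i> *\<^sub>C r) = k - \<i> *\<^sub>C r"
    using assms by (simp add: cstar_simps)
  ultimately have "k + \<i> *\<^sub>C r = 0" "k - \<i> *\<^sub>C r = 0"
    by simp_all
  then have "2 *\<^sub>R k = 0"
    unfolding scaleR_2 by (metis add_0 add_diff_cancel_left' diff_add_cancel add_cancel_left_right)
  then show ?thesis
    by simp
qed

text \<open>As \<open>1 + k * k\<close> lies in the unit ball, 1 minus it, which is
  \<open>- (k * k)\<close>, has a self-adjoint square root commuting with \<open>k\<close>.\<close>

lemma norm_one_plus_square_le_imp_zero:
  fixes k :: "'a::unital_cstar_algebra"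
  assumes sa: "star k = k" and le: "norm (1 + k * k) \<le> 1"
  shows "k = 0"
proof -
  have "star (1 + k * k) = 1 + k * k"
    by (simp add: cstar_simps sa)
  with le obtain r where r: "star r = r" "r * r = 1 - (1 + k * k)"
      "\<And>y. (1 + k * k) * y = y * (1 + k * k) \<Longrightarrow> r * y = y * r"
    using sqrt_one_minus by metis
  have "r * k = k * r"
    by (rule r(3)) (simp add: algebra_simps)
  with r(1,2) sa show ?thesis
    by (intro selfadjoint_squares_opposite[of k r]) simp_all
qed

section \<open>Sums of squares\<close>

text \<open>For self-adjoint elements this is positivity, stated without spectra.\<close>

definition norm_positive :: "'a::unital_cstar_algebra \<Rightarrow> bool" where
  "norm_positive h \<longleftrightarrow> (\<exists>R\<ge>0. norm (R *\<^sub>R 1 - h) \<le> R)"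

lemma norm_positive_add:
  assumes "norm_positive g" "norm_positive h"
  shows "norm_positive (g + h)"
proof -
  obtain R S where "0 \<le> R" "norm (R *\<^sub>R 1 - g) \<le> R" "0 \<le> S" "norm (S *\<^sub>R 1 - h) \<le> S"
    using assms by (auto simp: norm_positive_def)
  moreover have "(R + S) *\<^sub>R 1 - (g + h) = (R *\<^sub>R 1 - g) + (S *\<^sub>R 1 - h)"
    by (simp add: algebra_simps)
  ultimately show ?thesis
    unfolding norm_positive_def
    by (metis add_nonneg_nonneg norm_triangle_mono)
qed

lemma norm_positive_square:
  assumes "star d = d"
  shows "norm_positive (d * d)"
proof (cases "d = 0")
  case True
  then show ?thesis
    by (auto simp: norm_positive_def)
next
  case False
  define c where "c = (1 / norm d) *\<^sub>R d"
  have "norm (1 - c * c) \<le> 1"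
    by (rule norm_one_minus_square_le) (simp_all add: c_def star_scaleR assms False)
  moreover have "(norm d)\<^sup>2 *\<^sub>R 1 - d * d = (norm d)\<^sup>2 *\<^sub>R (1 - c * c)"
    using False by (simp add: c_def algebra_simps power2_eq_square)
  ultimately have "norm ((norm d)\<^sup>2 *\<^sub>R 1 - d * d) \<le> (norm d)\<^sup>2"
    by (simp add: mult_left_le)
  then show ?thesis
    unfolding norm_positive_def by (intro exI[of _ "(norm d)\<^sup>2"]) simp
qed

lemma norm_positive_minus_square_imp_zero:
  assumes sa: "star e = e" and pos: "norm_positive (- (e * e))"
  shows "e = 0"
proof -
  obtain R where R: "0 \<le> R" "norm (R *\<^sub>R 1 + e * e) \<le> R"
    using pos by (auto simp: norm_positive_def)
  show ?thesis
  proof (cases "R = 0")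
    case True
    then show ?thesis
      using R norm_selfadjoint_square[OF sa] by simp
  next
    case False
    \<comment> \<open>Scaled so that division by \<open>R\<close> turns the bound into
      \<open>norm (1 + k * k) <= 1\<close>.\<close>
    define k where "k = (1 / sqrt R) *\<^sub>R e"
    have "1 + k * k = (1 / R) *\<^sub>R (R *\<^sub>R 1 + e * e)"
      using False R by (simp add: k_def algebra_simps flip: real_sqrt_mult)
    then have "norm (1 + k * k) = norm (R *\<^sub>R 1 + e * e) / R"
      using R by (metis abs_of_nonneg divide_inverse_commute inverse_eq_divide norm_scaleR
          zero_le_divide_1_iff)
    then have "norm (1 + k * k) \<le> 1"
      using False R by (simp add: divide_le_eq)
    then have "k = 0"
      by (rule norm_one_plus_square_le_imp_zero[rotated]) (simp add: k_def star_scaleR sa)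
    then show ?thesis
      using False R by (simp add: k_def)
  qed
qed

text \<open>Kaplansky's trick: if \<open>w\<^sup>* w\<close> and \<open>w w\<^sup>*\<close> are both negatives of projections, then their sum, which
  is twice the sum of the squares of the real and imaginary parts of \<open>w\<close>, forces \<open>w\<^sup>* w = 0\<close>.\<close>

lemma star_mult_self_involution:
  fixes v :: "'a::unital_cstar_algebra"
  assumes inv: "invertible_elem v" and sq: "(star v * v) * (star v * v) = 1"
  shows "star v * v = 1"
proof -
  define h where "h = star v * v"
  define k where "k = v * star v"
  obtain z where z: "v * z = 1" "z * v = 1"
    using inv by (auto simp: invertible_elem_def)
  have hh: "h * h = 1"
    using sq by (simp add: h_def)
  have kv: "k * v = v * h"
    by (simp add: h_def k_def mult.assoc)
  \<comment> \<open>\<open>k\<close> is the conjugate of \<open>h\<close> by \<open>v\<close>, hence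
    an involution too.\<close>
  have kk: "k * k = 1"
  proof -
    have "k * k = k * k * (v * z)"
      by (simp add: z)
    also have "\<dots> = v * (h * h) * z"
      using kv by (metis mult.assoc)
    finally show ?thesis
      by (simp add: hh z)
  qed
  have sa: "star h = h" "star k = k"
    by (simp_all add: h_def k_def cstar_simps)
  \<comment> \<open>\<open>e\<close> and \<open>f\<close> are the spectral projections of
    \<open>h\<close> and \<open>k\<close> for the eigenvalue -1, so the goal becomes
    \<open>e = 0\<close>.\<close>
  define e where "e = (1/2) *\<^sub>R (1 - h)"
  define f where "f = (1/2) *\<^sub>R (1 - k)"
  have ee: "e * e = e" "f * f = f"
    by (simp_all add: e_def f_def algebra_simps hh kk flip: scaleR_left_distrib)
  have sae: "star e = e" "star f = f"
    by (simp_all add: e_def f_def cstar_simps sa)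
  define w where "w = v * e"
  have "star w * w = e * h * e"
    by (simp add: w_def h_def star_mult sae mult.assoc)
  also have "\<dots> = - e"
    by (simp add: e_def algebra_simps hh flip: scaleR_left_distrib)
  finally have ww: "star w * w = - e" .
  have "w * star w = v * (e * e) * star v"
    by (simp add: w_def star_mult sae mult.assoc)
  also have "\<dots> = v * e * star v"
    by (simp add: ee)
  also have "\<dots> = (1/2) *\<^sub>R (k - v * h * star v)"
    by (simp add: e_def k_def algebra_simps)
  also have "v * h * star v = k * k"
    by (simp add: h_def k_def mult.assoc)
  finally have ww': "w * star w = - f"
    by (simp add: kk f_def algebra_simps)
  obtain p q where pq: "star p = p" "star q = q" "w = p + \<i> *\<^sub>C q"
    using cartesian_decomposition by metis
  have "star w * w + w * star w = 2 *\<^sub>R (p * p + q * q)"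
    by (simp add: pq cstar_simps algebra_simps scaleR_2)
  \<comment> \<open>The right-hand side is a sum of squares of self-adjoint elements, which makes
    \<open>- (e * e)\<close> norm-positive.\<close>
  then have "- (e * e) = f * f + ((p * p + p * p) + (q * q + q * q))"
    using ww ww' by (simp add: ee scaleR_2 algebra_simps)
  moreover have "norm_positive (f * f + ((p * p + p * p) + (q * q + q * q)))"
    by (intro norm_positive_add norm_positive_square pq sae)
  ultimately have "e = 0"
    using norm_positive_minus_square_imp_zero sae by metis
  then show ?thesis
    by (simp add: e_def h_def)
qed

section \<open>Extreme points of the unit ball\<close>

text \<open>Midpoint form of extremality. It holds vacuously when \<open>norm v > 1\<close>, so
  membership in the unit ball is stated separately where it matters.\<close>

definition ball_extreme :: "'a::real_normed_vector \<Rightarrow> bool" where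
  "ball_extreme v \<longleftrightarrow> (\<forall>y. norm (v + y) \<le> 1 \<longrightarrow> norm (v - y) \<le> 1 \<longrightarrow> y = 0)"

text \<open>Averaging with adjoints shows that 1 + p and 1 - p are contractions for the real part p
  of \<open>x\<close>. The mean of their squares is 1 + p^2, so p = 0. Then x = i q, and
  \<open>star (1 + x) * (1 + x)\<close> is 1 + q^2, so q = 0.\<close>

lemma ball_extreme_one: "ball_extreme (1::'a::unital_cstar_algebra)"
  unfolding ball_extreme_def
proof (intro allI impI)
  fix x :: 'a
  assume le: "norm (1 + x) \<le> 1" "norm (1 - x) \<le> 1"
  obtain p q where pq: "star p = p" "star q = q" "x = p + \<i> *\<^sub>C q" and p: "p = (1/2) *\<^sub>R (x + star x)"
    using cartesian_decomposition by metis
  have contr: "norm (1 + y) \<le> 1 \<Longrightarrow> norm (1 + (1/2) *\<^sub>R (y + star y)) \<le> 1" for y :: 'a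
  proof -
    assume y: "norm (1 + y) \<le> 1"
    have "1 + (1/2) *\<^sub>R (y + star y) = (1/2) *\<^sub>R ((1 + y) + star (1 + y))"
      by (simp add: cstar_simps algebra_simps flip: scaleR_left_distrib)
    moreover have "norm ((1 + y) + star (1 + y)) \<le> 1 + 1"
      by (rule order_trans[OF norm_triangle_ineq]) (use y norm_star[of "1 + y"] in linarith)
    ultimately show ?thesis
      by simp
  qed
  have "norm (1 + p) \<le> 1"
    using contr[OF le(1)] by (simp add: p)
  moreover have "norm (1 - p) \<le> 1"
    using contr[of "- x"] le(2) by (simp add: p algebra_simps)
  ultimately have "norm ((1 + p) * (1 + p)) \<le> 1" "norm ((1 - p) * (1 - p)) \<le> 1"
    by (simp_all add: norm_mult_le_one)
  moreover have "1 + p * p = (1/2) *\<^sub>R ((1 + p) * (1 + p) + (1 - p) * (1 - p))"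
    by (simp add: algebra_simps flip: scaleR_left_distrib)
  ultimately have "norm (1 + p * p) \<le> 1"
    using norm_triangle_mono[of "(1 + p) * (1 + p)" 1 "(1 - p) * (1 - p)" 1] by simp
  then have "p = 0"
    using norm_one_plus_square_le_imp_zero pq by blast
  then have x: "x = \<i> *\<^sub>C q"
    using pq by simp
  have "norm (star (1 + x) * (1 + x)) \<le> 1"
    using le(1) by (intro norm_mult_le_one) simp_all
  moreover have "star (1 + x) * (1 + x) = 1 + q * q"
    by (simp add: x cstar_simps algebra_simps pq)
  ultimately have "q = 0"
    using norm_one_plus_square_le_imp_zero pq by metis
  then show "x = 0"
    by (simp add: x)
qed

lemma ball_extreme_isometry:
  fixes T :: "'a::real_normed_vector \<Rightarrow> 'b::real_normed_vector"
  assumes "ball_extreme v" and "linear T" and "surj T" and iso: "\<And>x. norm (T x) = norm x"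
  shows "ball_extreme (T v)"
  unfolding ball_extreme_def
proof (intro allI impI)
  fix y
  assume le: "norm (T v + y) \<le> 1" "norm (T v - y) \<le> 1"
  obtain x where y: "y = T x"
    using \<open>surj T\<close> by blast
  have "norm (v + x) \<le> 1" "norm (v - x) \<le> 1"
    using le iso[of "v + x"] iso[of "v - x"] by (simp_all add: y linear_add linear_diff \<open>linear T\<close>)
  then have "x = 0"
    using assms(1) by (auto simp: ball_extreme_def)
  then show "y = 0"
    by (simp add: y linear_0 \<open>linear T\<close>)
qed

lemma bimult_inverses:
  fixes a b c d x :: "'a::monoid_mult"
  assumes "a * c = 1" "d * b = 1"
  shows "a * (c * x * d) * b = x"
proof -
  have "a * (c * x * d) * b = (a * c) * x * (d * b)"
    by (simp only: mult.assoc)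
  with assms show ?thesis
    by simp
qed

lemma ball_extreme_bimult:
  fixes v :: "'a::unital_cstar_algebra"
  assumes "ball_extreme v" "invertible_elem a" "invertible_elem b"
    and "\<And>x. norm (a * x * b) = norm x"
  shows "ball_extreme (a * v * b)"
proof -
  obtain c d where cd: "a * c = 1" "d * b = 1"
    using assms by (auto simp: invertible_elem_def)
  have "surj (\<lambda>x. a * x * b)"
    by (rule surjI[where f = "\<lambda>x. c * x * d"]) (rule bimult_inverses[OF cd])
  moreover have "linear (\<lambda>x. a * x * b)"
    by (rule linearI) (simp_all add: algebra_simps)
  ultimately show ?thesis
    using ball_extreme_isometry[of v "\<lambda>x. a * x * b", OF assms(1)] assms(4) by simp
qed

lemma unitary_invertible: "unitary_elem u \<Longrightarrow> invertible_elem u"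
  by (auto simp: unitary_elem_def invertible_elem_def)

lemma unitary_one: "unitary_elem (1::'a::unital_cstar_algebra)"
  by (simp add: unitary_elem_def)

lemma norm_unitary_mult:
  fixes u :: "'a::unital_cstar_algebra"
  assumes "unitary_elem u"
  shows "norm (u * x) = norm x"
proof -
  have "star (u * x) * (u * x) = star x * (star u * u) * x"
    by (simp only: star_mult mult.assoc)
  also have "\<dots> = star x * x"
    using assms by (simp add: unitary_elem_def)
  finally have "(norm (u * x))\<^sup>2 = (norm x)\<^sup>2"
    by (metis norm_star_mult_self)
  then show ?thesis
    by simp
qed

text \<open>Left multiplication by \<open>u\<close> is a surjective linear isometry taking 1 to
  \<open>u\<close>.\<close>

lemma ball_extreme_unitary:
  fixes u :: "'a::unital_cstar_algebra"
  assumes "unitary_elem u"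
  shows "ball_extreme u"
  using ball_extreme_bimult[OF ball_extreme_one, of u 1] norm_unitary_mult[OF assms]
    unitary_invertible[OF assms] unitary_invertible[OF unitary_one] by simp

lemma unitary_if_invertible_isometry:
  fixes v :: "'a::unital_cstar_algebra"
  assumes "invertible_elem v" "star v * v = 1"
  shows "unitary_elem v"
proof -
  obtain z where "v * z = 1"
    using assms by (auto simp: invertible_elem_def)
  with assms(2) have "star v = z"
    by (metis mult.assoc mult.left_neutral mult.right_neutral)
  with \<open>v * z = 1\<close> assms show ?thesis
    by (simp add: unitary_elem_def)
qed

text \<open>With \<open>h = v\<^sup>* v\<close> and \<open>s\<close> a square root of \<open>1 - h\<^sup>2\<close>, the elements \<open>v (1 \<plusminus> i s / \<surd>2)\<close> lie in
  the unit ball, so extremality gives \<open>s = 0\<close>. Positivity of \<open>h\<close> is not available at this point,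
  hence \<open>1 - h\<^sup>2\<close> instead of \<open>1 - h\<close>.\<close>

lemma ball_extreme_invertible_imp_unitary:
  fixes v :: "'a::unital_cstar_algebra"
  assumes le: "norm v \<le> 1" and inv: "invertible_elem v" and ext: "ball_extreme v"
  shows "unitary_elem v"
proof -
  define h where "h = star v * v"
  have h: "star h = h" "norm h \<le> 1"
    using le by (simp_all add: h_def star_mult star_star norm_mult_le_one)
  obtain s where s: "star s = s" "s * s = 1 - h * h" "s * h = h * s"
    using selfadjoint_contraction_unitary[OF h] by metis
  define g where "g = s * s"
  have hh: "h * h = 1 - g"
    by (simp add: g_def s)
  have sg: "s * g = g * s"
    by (simp add: g_def mult.assoc)
  have gh: "g * h = h * g"
    by (simp add: g_def s(2) algebra_simps)
  have gh': "g * (h * x) = h * (g * x)" for x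
    using gh by (metis mult.assoc)
  have ng: "norm g \<le> 1"
    using norm_one_minus_square_le[OF h] by (simp add: g_def s)
  then have ns: "norm s \<le> 1"
    using norm_selfadjoint_square[OF s(1)] by (simp add: g_def power_le_one_iff)
  have sag: "star g = g"
    by (simp add: g_def star_mult s(1))
  \<comment> \<open>\<open>f\<close> will be the common value of
    \<open>star (v + y) * (v + y)\<close> and \<open>star (v - y) * (v - y)\<close> for the
    perturbation \<open>y\<close> below, so \<open>norm f <= 1\<close> is needed.\<close>
  define f where "f = h + (1/2) *\<^sub>R (h * g)"
  have saf: "star f = f"
    by (simp add: f_def cstar_simps h sag gh)
  text \<open>On the spectrum this is the identity
    \<open>1 - (h (3 - h\<^sup>2) / 2)\<^sup>2 = 3/4 (1 - h\<^sup>2)\<^sup>2 + 1/4 (1 - h\<^sup>2)\<^sup>3\<close>.\<close>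
  have "f * f = h * h + h * h * g + (1/4) *\<^sub>R (h * h * (g * g))"
    by (simp add: f_def gh gh' mult.assoc distrib_left distrib_right flip: scaleR_left_distrib)
      (simp add: algebra_simps flip: scaleR_left_distrib)
  also have "\<dots> = (3/4) *\<^sub>R (1 - g * g) + (1/4) *\<^sub>R (1 - (g * s) * (g * s))"
  proof -
    have "g * s * (g * s) = g * (g * g)"
      by (metis sg g_def mult.assoc)
    then show ?thesis
      by (simp add: hh algebra_simps flip: scaleR_left_distrib)
  qed
  finally have ff: "f * f = (3/4) *\<^sub>R (1 - g * g) + (1/4) *\<^sub>R (1 - (g * s) * (g * s))" .
  have "norm (1 - g * g) \<le> 1" "norm (1 - (g * s) * (g * s)) \<le> 1"
    by (intro norm_one_minus_square_le norm_mult_le_one ng ns sag; simp add: star_mult sag s sg)+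
  then have "norm (f * f) \<le> 3/4 + 1/4"
    unfolding ff by (intro norm_triangle_mono) simp_all
  then have nf: "norm f \<le> 1"
    using norm_selfadjoint_square[OF saf] by (simp add: power_le_one_iff)
  have expand: "star (v + v * w) * (v + v * w) = h + (h * w + star w * h) + star w * h * w" for w
    by (simp add: h_def star_add star_mult algebra_simps)
  \<comment> \<open>Here \<open>w\<close> is skew-adjoint and commutes with \<open>h\<close>, so the
    middle terms of \<open>expand\<close> cancel, and the last one is \<open>r * r\<close> times
    \<open>h * g\<close>.\<close>
  have perturb: "star (v + v * (r *\<^sub>R (\<i> *\<^sub>C s))) * (v + v * (r *\<^sub>R (\<i> *\<^sub>C s))) = f"
    if "r * r = 1/2" for r
    unfolding expand
    by (simp add: f_def g_def cstar_simps s(1,3) that algebra_simps)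
  define y where "y = v * ((1 / sqrt 2) *\<^sub>R (\<i> *\<^sub>C s))"
  have "star (v + y) * (v + y) = f" "star (v - y) * (v - y) = f"
    using perturb[of "1 / sqrt 2"] perturb[of "- (1 / sqrt 2)"] by (simp_all add: y_def)
  then have "(norm (v + y))\<^sup>2 \<le> 1" "(norm (v - y))\<^sup>2 \<le> 1"
    using nf by (metis norm_star_mult_self)+
  then have "y = 0"
    using ext by (simp add: ball_extreme_def power_le_one_iff)
  then have "\<i> *\<^sub>C \<i> *\<^sub>C (v * s) = 0"
    by (simp add: y_def mult_scaleC_right)
  then have "v * s = 0"
    by (simp add: scaleC_ii_ii)
  then have "s = 0"
    using inv by (metis invertible_elem_def mult.assoc mult.left_neutral mult_zero_right)
  \<comment> \<open>This only makes \<open>h\<close> an involution;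
    \<open>star_mult_self_involution\<close> excludes the eigenvalue -1.\<close>
  then have "h * h = 1"
    using s by simp
  then show ?thesis
    using star_mult_self_involution[OF inv] unitary_if_invertible_isometry[OF inv]
    by (simp add: h_def)
qed

section \<open>Central elements\<close>

text \<open>After scaling, a self-adjoint element is half the sum of a unitary and its adjoint,
  which is unitary as well.\<close>

lemma selfadjoint_commute_if_unitary_commute:
  fixes d k :: "'a::unital_cstar_algebra"
  assumes comm: "\<And>u. unitary_elem u \<Longrightarrow> u * k = k * u" and sa: "star d = d"
  shows "d * k = k * d"
proof (cases "d = 0")
  case False
  define c where "c = (1 / norm d) *\<^sub>R d"
  have c: "star c = c" "norm c \<le> 1"
    using False by (simp_all add: c_def star_scaleR sa)
  obtain s where s: "star s = s" and u: "unitary_elem (c + \<i> *\<^sub>C s)"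
    using selfadjoint_contraction_unitary[OF c] by metis
  define u where "u = c + \<i> *\<^sub>C s"
  have "unitary_elem (star u)"
    using u by (simp add: u_def[symmetric] unitary_elem_def star_star)
  then have "u * k + star u * k = k * u + k * star u"
    using comm u u_def by metis
  moreover have "u + star u = 2 *\<^sub>R c"
    by (simp add: u_def cstar_simps c s scaleR_2)
  ultimately have "(2 *\<^sub>R c) * k = k * (2 *\<^sub>R c)"
    by (metis distrib_left distrib_right)
  then show ?thesis
    using False by (simp add: c_def)
qed simp

lemma central_if_unitary_commute:
  fixes k :: "'a::unital_cstar_algebra"
  assumes "\<And>u. unitary_elem u \<Longrightarrow> u * k = k * u"
  shows "k \<in> algebra_center"
proof -
  have "k * x = x * k" for x
  proof -
    obtain p q where pq: "star p = p" "star q = q" "x = p + \<i> *\<^sub>C q"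
      using cartesian_decomposition by metis
    have "p * k = k * p" "q * k = k * q"
      using selfadjoint_commute_if_unitary_commute[of k] assms pq(1,2) by simp_all
    then show ?thesis
      by (simp add: pq(3) distrib_left distrib_right mult_scaleC_left mult_scaleC_right)
  qed
  then show ?thesis
    by (simp add: algebra_center_def)
qed

lemma scaleC_one_selfadjoint_real:
  assumes "star (c *\<^sub>C 1) = c *\<^sub>C (1::'a::unital_cstar_algebra)" and "(1::'a) \<noteq> 0"
  shows "c *\<^sub>C 1 = Re c *\<^sub>R (1::'a)"
proof -
  have "(cnj c - c) *\<^sub>C (1::'a) = cnj c *\<^sub>C 1 - c *\<^sub>C 1"
    using scaleC_add_left[of "cnj c - c" c "1::'a"] by simp
  also have "\<dots> = 0"
    using assms by (simp add: star_scaleC)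
  finally have "cmod (cnj c - c) * norm (1::'a) = 0"
    by (metis norm_scaleC norm_zero)
  then have "c = complex_of_real (Re c)"
    using assms(2) by (simp add: complex_eq_iff)
  then show ?thesis
    by (metis scaleC_of_real)
qed

text \<open>For negative \<open>c\<close>, rescaling gives an invertible \<open>w\<close> with
  \<open>star w * w = - 1\<close>. The square of this is 1, so
  \<open>star_mult_self_involution\<close> yields 1 = -1.\<close>

lemma star_mult_self_scalar_positive:
  fixes v :: "'a::unital_cstar_algebra"
  assumes inv: "invertible_elem v" and eq: "star v * v = c *\<^sub>R 1" and "(1::'a) \<noteq> 0"
  shows "0 < c"
proof (rule ccontr)
  assume "\<not> 0 < c"
  moreover have "c \<noteq> 0"
  proof
    assume "c = 0"
    then have "v = 0"
      using norm_star_mult_self[of v] eq by simp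
    then show False
      using inv \<open>1 \<noteq> 0\<close> by (simp add: invertible_elem_def)
  qed
  ultimately have "c < 0"
    by simp
  define w where "w = (1 / sqrt (- c)) *\<^sub>R v"
  have ww: "star w * w = - 1"
    using \<open>c < 0\<close> by (simp add: w_def star_scaleR eq flip: real_sqrt_mult)
  obtain z where "v * z = 1" "z * v = 1"
    using inv by (auto simp: invertible_elem_def)
  then have "invertible_elem w"
    using \<open>c < 0\<close> unfolding invertible_elem_def
    by (intro exI[of _ "sqrt (- c) *\<^sub>R z"]) (simp add: w_def)
  then have "star w * w = 1"
    by (rule star_mult_self_involution) (simp add: ww)
  then have "2 *\<^sub>R (1::'a) = 0"
    unfolding scaleR_2 by (metis ww add.right_inverse)
  then show False
    using \<open>1 \<noteq> 0\<close> by simp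
qed

section \<open>Isometric bimultiplications and unitaries\<close>

lemma unitary_bimult:
  fixes a b :: "'a::unital_cstar_algebra"
  assumes a: "invertible_elem a" and b: "invertible_elem b"
    and iso: "\<And>x. norm (a * x * b) = norm x" and u: "unitary_elem u"
  shows "unitary_elem (a * u * b)"
proof (rule ball_extreme_invertible_imp_unitary)
  show "norm (a * u * b) \<le> 1"
    using unitary_norm_le[OF u] by (simp add: iso)
  show "ball_extreme (a * u * b)"
    using ball_extreme_bimult[OF ball_extreme_unitary[OF u] a b] iso by blast
  obtain c d where cd: "a * c = 1" "c * a = 1" "b * d = 1" "d * b = 1"
    using a b by (auto simp: invertible_elem_def)
  have "(a * u * b) * (d * star u * c) = a * (u * ((b * d) * star u)) * c"
    "(d * star u * c) * (a * u * b) = d * (star u * ((c * a) * u)) * b"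
    by (simp_all only: mult.assoc)
  then show "invertible_elem (a * u * b)"
    using u cd by (auto simp: invertible_elem_def unitary_elem_def)
qed

lemma bimult_isometry_central:
  fixes a b :: "'a::unital_cstar_algebra"
  assumes a: "invertible_elem a" and b: "invertible_elem b"
    and iso: "\<And>x. norm (a * x * b) = norm x"
  shows "b * star b \<in> algebra_center" and "star a * a * (b * star b) = 1"
proof -
  obtain c where c: "a * c = 1" "c * a = 1"
    using a by (auto simp: invertible_elem_def)
  then have sc: "star a * star c = 1" "star c * star a = 1"
    by (metis star_mult star_one)+
  \<comment> \<open>Obtained from \<open>(a * u * b) * star (a * u * b) = 1\<close> by multiplying
    with \<open>c\<close> on the left and \<open>star c\<close> on the right.\<close>
  have conj: "u * (b * star b) * star u = c * star c" if "unitary_elem u" for u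
  proof -
    have "(a * u * b) * star (a * u * b) = 1"
      using unitary_bimult[OF assms that] by (simp add: unitary_elem_def)
    then have "c * (a * (u * (b * star b) * star u) * star a) * star c = c * star c"
      by (simp add: star_mult mult.assoc)
    then show ?thesis
      using bimult_inverses[OF c(2) sc(1)] by metis
  qed
  have k: "b * star b = c * star c"
    using conj[OF unitary_one] by simp
  show "b * star b \<in> algebra_center"
  proof (rule central_if_unitary_commute)
    fix u :: 'a
    assume u: "unitary_elem u"
    have "u * (b * star b) = u * (b * star b) * (star u * u)"
      using u by (simp add: unitary_elem_def)
    also have "\<dots> = (u * (b * star b) * star u) * u"
      by (simp only: mult.assoc)
    also have "\<dots> = b * star b * u"
      using conj[OF u] k by simp
    finally show "u * (b * star b) = b * star b * u" .
  qed
  have "star a * a * (b * star b) = star a * (a * c) * star c"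
    unfolding k by (simp only: mult.assoc)
  then show "star a * a * (b * star b) = 1"
    by (simp add: c sc)
qed

lemma invertible_star: "invertible_elem (a::'a::unital_cstar_algebra) \<Longrightarrow> invertible_elem (star a)"
  unfolding invertible_elem_def by (metis star_mult star_one)

lemma invertible_scaleR:
  assumes "invertible_elem (a::'a::unital_cstar_algebra)" "r \<noteq> 0"
  shows "invertible_elem (r *\<^sub>R a)"
proof -
  obtain c where "a * c = 1" "c * a = 1"
    using assms by (auto simp: invertible_elem_def)
  then show ?thesis
    unfolding invertible_elem_def using assms(2) by (intro exI[of _ "(1 / r) *\<^sub>R c"]) simp
qed

lemma unitary_star_iff: "unitary_elem (star u) \<longleftrightarrow> unitary_elem (u::'a::unital_cstar_algebra)"
  by (auto simp: unitary_elem_def star_star)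

text \<open>If \<open>b * star b\<close> is the scalar \<open>c\<close>, then
  \<open>star a * a\<close> is its inverse, so \<open>l = sqrt c\<close> normalizes both
  factors.\<close>

lemma trivial_center_imp_bimult_isometry_unitary:
  fixes a b :: "'a::unital_cstar_algebra"
  assumes center: "(algebra_center :: 'a set) = range (\<lambda>c. c *\<^sub>C 1)"
    and a: "invertible_elem a" and b: "invertible_elem b"
    and iso: "\<And>x. norm (a * x * b) = norm x" and nz: "(1::'a) \<noteq> 0"
  shows "\<exists>l::real. 0 < l \<and> unitary_elem (l *\<^sub>R a) \<and> unitary_elem ((1 / l) *\<^sub>R b)"
proof -
  obtain z where z: "b * star b = z *\<^sub>C 1"
    using bimult_isometry_central(1)[OF a b iso] center by auto
  define c where "c = Re z"
  have "star (z *\<^sub>C (1::'a)) = z *\<^sub>C 1"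
    by (simp add: z[symmetric] star_mult star_star)
  then have bb: "b * star b = c *\<^sub>R 1"
    using scaleC_one_selfadjoint_real nz by (metis z c_def)
  then have c: "0 < c"
    using star_mult_self_scalar_positive[OF invertible_star[OF b]] nz by (simp add: star_star)
  have aa: "c *\<^sub>R (star a * a) = 1"
    using bimult_isometry_central(2)[OF a b iso] by (simp add: bb)
  have "unitary_elem (sqrt c *\<^sub>R a)"
    using c aa
    by (intro unitary_if_invertible_isometry invertible_scaleR a)
      (simp_all add: star_scaleR flip: real_sqrt_mult)
  \<comment> \<open>The known product is \<open>b * star b\<close>, which is the isometry condition
    for the adjoint of \<open>b\<close>.\<close>
  moreover have "unitary_elem (star ((1 / sqrt c) *\<^sub>R b))"
    using c bb
    by (intro unitary_if_invertible_isometry invertible_star invertible_scaleR b)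
      (simp_all add: star_scaleR star_star flip: real_sqrt_mult)
  ultimately show ?thesis
    using c by (intro exI[of _ "sqrt c"]) (simp add: unitary_star_iff)
qed

section \<open>From the condition on bimultiplications to a trivial center\<close>

lemma one_minus_right_inverse:
  fixes x :: "'a::{real_normed_algebra, banach, monoid_mult}"
  assumes "norm x < 1"
  obtains y where "(1 - x) * y = 1"
proof -
  \<comment> \<open>The inverse is the fixed point of the contraction sending \<open>y\<close> to
    \<open>1 + x * y\<close>.\<close>
  have "dist (1 + x * y) (1 + x * z) \<le> norm x * dist y z" for y z
    using norm_mult_ineq[of x "y - z"] by (simp add: dist_norm algebra_simps)
  then have "\<exists>!y. 1 + x * y = y"
    using assms by (intro banach_fix_type[where c = "norm x"]) auto
  then obtain y where "1 + x * y = y"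
    by auto
  then have "(1 - x) * y = 1"
    by (simp add: algebra_simps)
  then show ?thesis
    using that by blast
qed

lemma central_commute: "z \<in> algebra_center \<Longrightarrow> z * a = a * z"
  by (simp add: algebra_center_def)

lemma central_square_scalar:
  fixes x :: "'a::unital_cstar_algebra"
  assumes H: "\<And>a b :: 'a. invertible_elem a \<Longrightarrow> invertible_elem b \<Longrightarrow> (\<And>x. norm (a * x * b) = norm x)
      \<Longrightarrow> \<exists>l::real. 0 < l \<and> unitary_elem (l *\<^sub>R a) \<and> unitary_elem ((1 / l) *\<^sub>R b)"
    and x: "x \<in> algebra_center" "star x = x" "norm x < 1"
  shows "\<exists>r::real. (1 - x) * (1 - x) = r *\<^sub>R 1"
proof -
  define h where "h = 1 - x"
  have hc: "h * y = y * h" for y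
    using central_commute[OF x(1)] by (simp add: h_def algebra_simps)
  obtain y where y: "h * y = 1"
    using one_minus_right_inverse[OF x(3)] by (auto simp: h_def)
  then have y': "y * h = 1"
    using hc by metis
  \<comment> \<open>Centrality moves \<open>h\<close> past \<open>w\<close>, so the bimultiplication
    by \<open>h\<close> and its inverse \<open>y\<close> is the identity and \<open>H\<close>
    applies.\<close>
  have "h * w * y = w" for w
    by (metis hc mult.assoc mult.right_neutral y)
  then obtain l :: real where l: "0 < l" "unitary_elem (l *\<^sub>R h)"
    using H[of h y] y y' by (auto simp: invertible_elem_def)
  have "star h = h"
    by (simp add: h_def star_diff x)
  then have "(l * l) *\<^sub>R (h * h) = 1"
    using l(2) by (simp add: unitary_elem_def star_scaleR)
  then have "h * h = (1 / (l * l)) *\<^sub>R 1"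
    using l(1) by (metis divide_inverse_commute mult.right_neutral inverse_eq_divide less_irrefl
        mult_eq_0_iff scaleR_one scaleR_scaleR right_inverse mult.commute)
  then show ?thesis
    by (auto simp: h_def)
qed

lemma central_selfadjoint_scalar:
  fixes z :: "'a::unital_cstar_algebra"
  assumes H: "\<And>a b :: 'a. invertible_elem a \<Longrightarrow> invertible_elem b \<Longrightarrow> (\<And>x. norm (a * x * b) = norm x)
      \<Longrightarrow> \<exists>l::real. 0 < l \<and> unitary_elem (l *\<^sub>R a) \<and> unitary_elem ((1 / l) *\<^sub>R b)"
    and z: "z \<in> algebra_center" "star z = z"
  shows "\<exists>r::real. z = r *\<^sub>R 1"
proof -
  \<comment> \<open>\<open>t\<close> scales \<open>z\<close> into the open unit ball, where
    \<open>central_square_scalar\<close> applies to both signs.\<close>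
  define t where "t = 1 / (1 + norm z)"
  have t: "0 < t"
    by (simp add: t_def add_pos_nonneg)
  define x where "x = t *\<^sub>R z"
  have x: "x \<in> algebra_center" "star x = x" "norm x < 1"
    using z t by (auto simp: x_def algebra_center_def star_scaleR t_def)
  then have "- x \<in> algebra_center" "star (- x) = - x" "norm (- x) < 1"
    by (simp_all add: algebra_center_def)
  then obtain r s :: real where "(1 - x) * (1 - x) = r *\<^sub>R 1" "(1 - - x) * (1 - - x) = s *\<^sub>R 1"
    using central_square_scalar[OF H, of x] central_square_scalar[OF H, of "- x"] x by metis
  moreover have "(1 - - x) * (1 - - x) - (1 - x) * (1 - x) = 4 *\<^sub>R x"
    using scaleR_left_distrib[of 2 2 x] by (simp add: algebra_simps scaleR_2)
  ultimately have "(4 * t) *\<^sub>R z = (s - r) *\<^sub>R 1"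
    by (simp add: x_def scaleR_left_diff_distrib)
  then have "z = ((s - r) / (4 * t)) *\<^sub>R 1"
    using t by (metis divide_inverse_commute scaleR_scaleR left_inverse scaleR_one less_irrefl
        mult_eq_0_iff zero_neq_numeral)
  then show ?thesis
    by blast
qed

lemma bimult_isometry_unitary_imp_trivial_center:
  assumes H: "\<And>a b :: 'a::unital_cstar_algebra. invertible_elem a \<Longrightarrow> invertible_elem b \<Longrightarrow>
      (\<And>x. norm (a * x * b) = norm x)
      \<Longrightarrow> \<exists>l::real. 0 < l \<and> unitary_elem (l *\<^sub>R a) \<and> unitary_elem ((1 / l) *\<^sub>R b)"
  shows "(algebra_center :: 'a set) = range (\<lambda>c. c *\<^sub>C 1)"
proof (rule equalityI)
  show "range (\<lambda>c. c *\<^sub>C (1::'a)) \<subseteq> algebra_center"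
    by (auto simp: algebra_center_def mult_scaleC_left mult_scaleC_right)
  show "(algebra_center :: 'a set) \<subseteq> range (\<lambda>c. c *\<^sub>C 1)"
  proof
    fix z :: 'a
    assume z: "z \<in> algebra_center"
    obtain p q where pq: "star p = p" "star q = q" "z = p + \<i> *\<^sub>C q"
      "p = (1/2) *\<^sub>R (z + star z)" "q = (1/2) *\<^sub>R (\<i> *\<^sub>C (star z - z))"
      using cartesian_decomposition by blast
    have zs: "z * y = y * z" for y
      by (rule central_commute[OF z])
    \<comment> \<open>Adjoint of the relation \<open>z * star y = star y * z\<close>.\<close>
    have sz: "star z * y = y * star z" for y
      by (metis zs star_mult star_star)
    have "p \<in> algebra_center" "q \<in> algebra_center"
      unfolding pq(4,5) algebra_center_def
      by (simp_all add: distrib_left distrib_right left_diff_distrib right_diff_distrib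
          mult_scaleC_left mult_scaleC_right zs sz)
    then obtain r s :: real where "p = r *\<^sub>R 1" "q = s *\<^sub>R 1"
      using central_selfadjoint_scalar[OF H] pq(1,2) by metis
    then have "z = (complex_of_real r + \<i> * complex_of_real s) *\<^sub>C 1"
      unfolding pq(3) by (simp only: scaleC_add_left scaleC_of_real flip: scaleC_scaleC)
    then show "z \<in> range (\<lambda>c. c *\<^sub>C 1)"
      by blast
  qed
qed

theorem theorem2p7:
  shows "(algebra_center :: 'a::unital_cstar_algebra set) = range (\<lambda>c. c *\<^sub>C 1) \<longleftrightarrow>
    (\<forall>a b :: 'a. invertible_elem a \<longrightarrow> invertible_elem b \<longrightarrow>
      (\<forall>x. norm (a * x * b) = norm x) \<longrightarrow>
      (\<exists>l::real. 0 < l \<and> unitary_elem (l *\<^sub>R a) \<and> unitary_elem ((1 / l) *\<^sub>R b)))"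
proof (cases "(1::'a) = 0")
  \<comment> \<open>In the zero algebra all elements coincide, so both sides hold. Otherwise
    \<open>1 \<noteq> 0\<close> ensures that the scalar \<open>b * star b\<close> is
    positive.\<close>
  case True
  then have "x = 0" for x :: 'a
    by (metis mult.right_neutral mult_zero_right)
  then have all_eq: "x = y" for x y :: 'a
    by metis
  then have "unitary_elem x" for x :: 'a
    unfolding unitary_elem_def by blast
  moreover have "(algebra_center :: 'a set) = range (\<lambda>c. c *\<^sub>C 1)"
    using all_eq by (auto simp: algebra_center_def)
  ultimately show ?thesis
    by (meson zero_less_one)
next
  case False
  show ?thesis
    using trivial_center_imp_bimult_isometry_unitary[OF _ _ _ _ False]
      bimult_isometry_unitary_imp_trivial_center[where 'a = 'a]
    by (intro iffI allI impI) simp_all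
qed

end
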